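(* Let $F=(W,\sim)$ be a $\kappa$-frame. Then the unravelled frame $U(F)$ is a $\kappa$-frame.
   Context: Fix a finite set $\mathsf{Ag}$ of agents; an agent pattern is a set $G\subseteq\mathcal{P}(\mathsf{Ag})\setminus\{\emptyset\}$. A frame is a pair $F=(W,\sim)$ where $W$ is a set and $\sim$ assigns to each agent pattern $G$ a symmetric and transitive relation $\sim_G$ on $W$. Let $\mathsf{alive}(G)=\{w\mid w\sim_G w\}$. $F$ is a $\kappa$-frame if for all agent patterns $G,H$: (K1) $\mathsf{alive}(G)\cap\mathsf{alive}(H)\subseteq\mathsf{alive}(G\cup H)$; (K2) $\mathsf{alive}(G)\subseteq\mathsf{alive}(\{A\cup B\})$ for $A,B\in G$; (K3) $\sim_H\subseteq\sim_G$ if $G\subseteq H$; (K4) $\sim_G\subseteq\sim_{G\cup\{B\}}$ if some $A\in G$ has $\emptyset\ne B\subseteq A$; (NE) every $w\in W$ has an agent pattern $G$ with $w\sim_G w$. A history over $F$ is a nonempty finite sequence of triples $(w,G,v)$ such that for each triple, $w\sim_G v$ and $G$ is maximal under set inclusion (no agent pattern $G'\supsetneq G$ has $w\sim_{G'}v$), and if $(w',G',v')$ is the successor of $(w,G,v)$ then $v=w'$. $\ell(h)$ denotes the last world of $h$ (the third component of its last triple); $h\parallel(\ell(h),G,v)$ denotes the extension of $h$ by that triple; $H_F$ is the set of all histories. For histories $h,h'$ and agent pattern $G$: $h\to_G h'$ iff $h'=h\parallel(\ell(h),U,\ell(h'))$ for some $U$ with $G\subseteq U$. Let $\approx_G$ be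 the transitive closure of $\to_G\cup\to_G^{-1}$. The unravelled frame is $U(F)=(H_F,\{\approx_G\}_G)$. *)

theory Defs
  imports Main
begin

definition agent_patterns :: "'a set \<Rightarrow> 'a set set set" where
  "agent_patterns Ag = Pow (Pow Ag - {{}})"

text \<open>Patterns are arguments of a total function, so \<^term>\<open>indist F G\<close> is also defined when
  \<^term>\<open>G\<close> is not an agent pattern over \<^term>\<open>Ag\<close>; such values carry no meaning, and every
  condition below is restricted to \<^term>\<open>agent_patterns Ag\<close>.\<close>

record ('a, 'w) frame =
  worlds :: "'w set"
  indist :: "'a set set \<Rightarrow> ('w \<times> 'w) set"

definition is_frame :: "'a set \<Rightarrow> ('a, 'w) frame \<Rightarrow> bool" where
  "is_frame Ag F \<longleftrightarrow>
     (\<forall>G \<in> agent_patterns Ag.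
        indist F G \<subseteq> worlds F \<times> worlds F \<and> sym (indist F G) \<and> trans (indist F G))"

definition alive :: "('a, 'w) frame \<Rightarrow> 'a set set \<Rightarrow> 'w set" where
  "alive F G = {w \<in> worlds F. (w, w) \<in> indist F G}"

definition K1 :: "'a set \<Rightarrow> ('a, 'w) frame \<Rightarrow> bool" where
  "K1 Ag F \<longleftrightarrow>
     (\<forall>G \<in> agent_patterns Ag. \<forall>H \<in> agent_patterns Ag.
        alive F G \<inter> alive F H \<subseteq> alive F (G \<union> H))"

definition K2 :: "'a set \<Rightarrow> ('a, 'w) frame \<Rightarrow> bool" where
  "K2 Ag F \<longleftrightarrow>
     (\<forall>G \<in> agent_patterns Ag. \<forall>A \<in> G. \<forall>B \<in> G. alive F G \<subseteq> alive F {A \<union> B})"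

definition K3 :: "'a set \<Rightarrow> ('a, 'w) frame \<Rightarrow> bool" where
  "K3 Ag F \<longleftrightarrow>
     (\<forall>G \<in> agent_patterns Ag. \<forall>H \<in> agent_patterns Ag.
        G \<subseteq> H \<longrightarrow> indist F H \<subseteq> indist F G)"

definition K4 :: "'a set \<Rightarrow> ('a, 'w) frame \<Rightarrow> bool" where
  "K4 Ag F \<longleftrightarrow>
     (\<forall>G \<in> agent_patterns Ag. \<forall>B.
        (\<exists>A \<in> G. B \<noteq> {} \<and> B \<subseteq> A) \<longrightarrow> indist F G \<subseteq> indist F (G \<union> {B}))"

definition NE :: "'a set \<Rightarrow> ('a, 'w) frame \<Rightarrow> bool" where
  "NE Ag F \<longleftrightarrow> (\<forall>w \<in> worlds F. \<exists>G \<in> agent_patterns Ag. (w, w) \<in> indist F G)"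

definition kappa_frame :: "'a set \<Rightarrow> ('a, 'w) frame \<Rightarrow> bool" where
  "kappa_frame Ag F \<longleftrightarrow>
     is_frame Ag F \<and> K1 Ag F \<and> K2 Ag F \<and> K3 Ag F \<and> K4 Ag F \<and> NE Ag F"

type_synonym ('a, 'w) history = "('w \<times> 'a set set \<times> 'w) list"

definition maximal_step :: "'a set \<Rightarrow> ('a, 'w) frame \<Rightarrow> 'w \<times> 'a set set \<times> 'w \<Rightarrow> bool" where
  "maximal_step Ag F = (\<lambda>(w, G, v).
     G \<in> agent_patterns Ag \<and> (w, v) \<in> indist F G \<and>
     \<not> (\<exists>G' \<in> agent_patterns Ag. G \<subset> G' \<and> (w, v) \<in> indist F G'))"

definition histories :: "'a set \<Rightarrow> ('a, 'w) frame \<Rightarrow> ('a, 'w) history set" where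
  "histories Ag F = {h. h \<noteq> [] \<and> (\<forall>t \<in> set h. maximal_step Ag F t) \<and>
     (\<forall>i. Suc i < length h \<longrightarrow> snd (snd (h ! i)) = fst (h ! Suc i))}"

definition last_world :: "('a, 'w) history \<Rightarrow> 'w" where
  "last_world h = snd (snd (last h))"

definition hist_step ::
    "'a set \<Rightarrow> ('a, 'w) frame \<Rightarrow> 'a set set \<Rightarrow> (('a, 'w) history \<times> ('a, 'w) history) set" where
  "hist_step Ag F G = {(h, h'). h \<in> histories Ag F \<and> h' \<in> histories Ag F \<and>
     (\<exists>U \<in> agent_patterns Ag. G \<subseteq> U \<and> h' = h @ [(last_world h, U, last_world h')])}"

definition unravel :: "'a set \<Rightarrow> ('a, 'w) frame \<Rightarrow> ('a, ('a, 'w) history) frame" where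
  "unravel Ag F =
     \<lparr>worlds = histories Ag F,
      indist = (\<lambda>G. (hist_step Ag F G \<union> (hist_step Ag F G)\<inverse>)\<^sup>+)\<rparr>"

end

theory Submission
  imports Defs
begin

text \<open>A history is alive for \<open>G\<close> in the unravelling exactly when its last world is alive for \<open>G\<close>
  in \<open>F\<close>: if the last world is alive, appending a reflexive triple with a maximal pattern above
  \<open>G\<close> and going back yields a \<open>G\<close>-loop. This transfers the properties that only speak about
  aliveness (K1, K2, NE). K4 already holds for single steps, since maximality of a step's
  pattern together with K4 in \<open>F\<close> makes that pattern closed under nonempty subsets.\<close>

text \<open>A finite \<open>Ag\<close> has only finitely many patterns, so among those relating
  \<open>w\<close> to \<open>v\<close> some maximal one lies above \<open>G\<close>.\<close>

lemma ex_maximal_step: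
  assumes "finite Ag" "G \<in> agent_patterns Ag" "(w, v) \<in> indist F G"
  obtains U where "G \<subseteq> U" "maximal_step Ag F (w, U, v)"
proof -
  let ?S = "{U \<in> agent_patterns Ag. (w, v) \<in> indist F U}"
  have "finite ?S"
    using assms(1) by (simp add: agent_patterns_def)
  moreover have "G \<in> ?S"
    using assms by simp
  ultimately have "\<exists>U \<in> ?S. G \<subseteq> U \<and> (\<forall>V \<in> ?S. U \<subseteq> V \<longrightarrow> U = V)"
    by (rule finite_has_maximal2)
  then obtain U where "U \<in> ?S" "G \<subseteq> U" "\<forall>V \<in> ?S. U \<subseteq> V \<longrightarrow> U = V"
    by blast
  then have "maximal_step Ag F (w, U, v)"
    unfolding maximal_step_def by blast
  with \<open>G \<subseteq> U\<close> show thesis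
    by (rule that)
qed

text \<open>If \<open>B\<close> were missing, K4 would relate \<open>w\<close> to \<open>v\<close>
  under the strictly larger pattern \<open>U \<union> {B}\<close>, against maximality.\<close>

lemma maximal_step_closed:
  assumes "K4 Ag F" "maximal_step Ag F (w, U, v)" "A \<in> U" "B \<noteq> {}" "B \<subseteq> A"
  shows "B \<in> U"
proof (rule ccontr)
  assume "B \<notin> U"
  have U: "U \<in> agent_patterns Ag" "(w, v) \<in> indist F U"
    using assms(2) by (auto simp: maximal_step_def)
  have "(w, v) \<in> indist F (U \<union> {B})"
    using assms U unfolding K4_def by blast
  moreover have "U \<union> {B} \<in> agent_patterns Ag"
    using U(1) assms(3-5) by (auto simp: agent_patterns_def)
  ultimately show False
    using assms(2) \<open>B \<notin> U\<close> unfolding maximal_step_def by blast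
qed

lemma history_snoc:
  assumes "h \<in> histories Ag F" "maximal_step Ag F (last_world h, U, v)"
  shows "h @ [(last_world h, U, v)] \<in> histories Ag F"
proof -
  have ne: "h \<noteq> []"
    using assms(1) by (simp add: histories_def)
  have "snd (snd ((h @ [(last_world h, U, v)]) ! i)) = fst ((h @ [(last_world h, U, v)]) ! Suc i)"
    if i: "Suc i < length (h @ [(last_world h, U, v)])" for i
  proof (cases "Suc i < length h")
    case True
    then show ?thesis
      using assms(1) by (simp add: nth_append histories_def)
  next
    case False
    \<comment> \<open>The seam: \<open>h ! i\<close> is the last triple of \<open>h\<close>, and the
      new triple starts at \<open>last_world h\<close> by construction.\<close>
    then have "Suc i = length h"
      using i by simp
    moreover from this have "h ! i = last h"
      using ne by (metis diff_Suc_1 last_conv_nth)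
    ultimately show ?thesis
      by (simp add: nth_append last_world_def)
  qed
  then show ?thesis
    using assms by (auto simp: histories_def)
qed

text \<open>\<open>hist_step\<close> asks only that \<open>U\<close> be a pattern; maximality comes
  from the new triple being an entry of the history \<open>h'\<close>.\<close>

lemma hist_step_maximal:
  assumes "(h, h') \<in> hist_step Ag F G"
  obtains U where "G \<subseteq> U" "h' = h @ [(last_world h, U, last_world h')]"
    "maximal_step Ag F (last_world h, U, last_world h')"
proof -
  obtain U where U: "G \<subseteq> U" "h' = h @ [(last_world h, U, last_world h')]"
    using assms unfolding hist_step_def by blast
  have "h' \<in> histories Ag F"
    using assms unfolding hist_step_def by blast
  then have "\<forall>t \<in> set h'. maximal_step Ag F t"
    by (simp add: histories_def)
  moreover have "(last_world h, U, last_world h') \<in> set h'"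
    \<comment> \<open>The equation has \<open>h'\<close> on both sides, so a single occurrence is
      replaced.\<close>
    by (subst U(2)) simp
  ultimately show thesis
    using that U by blast
qed

text \<open>\<open>histories\<close> does not mention \<open>worlds F\<close>; membership comes from
  the last triple, whose relation stays inside the carrier.\<close>

lemma last_world_in_worlds:
  assumes "is_frame Ag F" "h \<in> histories Ag F"
  shows "last_world h \<in> worlds F"
proof -
  have "maximal_step Ag F (last h)"
    using assms(2) by (simp add: histories_def)
  then show ?thesis
    using assms(1) by (auto simp: maximal_step_def is_frame_def last_world_def split: prod.splits)
qed

lemma hist_step_indist:
  assumes "K3 Ag F" "G \<in> agent_patterns Ag" "(h, h') \<in> hist_step Ag F G"
  shows "(last_world h, last_world h') \<in> indist F G"
proof -
  obtain U where "G \<subseteq> U" "maximal_step Ag F (last_world h, U, last_world h')"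
    using hist_step_maximal[OF assms(3)] by metis
  then show ?thesis
    using assms(1,2) unfolding K3_def maximal_step_def by blast
qed

lemma alive_unravel:
  assumes "finite Ag" "is_frame Ag F" "K3 Ag F" "G \<in> agent_patterns Ag"
  shows "alive (unravel Ag F) G = {h \<in> histories Ag F. last_world h \<in> alive F G}"
proof (intro equalityI subsetI)
  fix h
  assume "h \<in> alive (unravel Ag F) G"
  then have h: "h \<in> histories Ag F"
    and loop: "(h, h) \<in> (hist_step Ag F G \<union> (hist_step Ag F G)\<inverse>)\<^sup>+"
    by (auto simp: alive_def unravel_def)
  \<comment> \<open>\<open>trancl\<close> does not add reflexivity, so a loop at \<open>h\<close>
    has a first edge. Its other end \<open>h'\<close> suffices, because a symmetric and transitive
    relation is reflexive at every point that it relates to something.\<close>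
  from loop obtain h' where "(h, h') \<in> hist_step Ag F G \<or> (h', h) \<in> hist_step Ag F G"
    by (auto dest: tranclD)
  then have "(last_world h, last_world h') \<in> indist F G \<or> (last_world h', last_world h) \<in> indist F G"
    using hist_step_indist[OF assms(3,4)] by blast
  moreover have "sym (indist F G)" "trans (indist F G)"
    using assms(2,4) by (auto simp: is_frame_def)
  ultimately have "(last_world h, last_world h) \<in> indist F G"
    by (meson symD transD)
  then show "h \<in> {h \<in> histories Ag F. last_world h \<in> alive F G}"
    using h last_world_in_worlds[OF assms(2)] by (simp add: alive_def)
next
  fix h
  assume "h \<in> {h \<in> histories Ag F. last_world h \<in> alive F G}"
  then have h: "h \<in> histories Ag F" and refl: "(last_world h, last_world h) \<in> indist F G"
    by (auto simp: alive_def)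
  obtain U where U: "G \<subseteq> U" "maximal_step Ag F (last_world h, U, last_world h)"
    using ex_maximal_step[OF assms(1,4) refl] .
  let ?h' = "h @ [(last_world h, U, last_world h)]"
  have "last_world ?h' = last_world h"
    by (simp add: last_world_def)
  moreover have "U \<in> agent_patterns Ag"
    using U(2) by (simp add: maximal_step_def)
  ultimately have "(h, ?h') \<in> hist_step Ag F G"
    using h U(1) history_snoc[OF h U(2)] by (auto simp: hist_step_def)
  then have "(h, h) \<in> (hist_step Ag F G \<union> (hist_step Ag F G)\<inverse>)\<^sup>+"
    by (meson UnCI converseI r_into_trancl' trancl_into_trancl)
  then show "h \<in> alive (unravel Ag F) G"
    using h by (simp add: alive_def unravel_def)
qed

text \<open>Reduces K3 and K4 to inclusions between single steps, since symmetrising and closing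
  transitively are both monotone.\<close>

lemma unravel_indist_mono:
  assumes "hist_step Ag F G \<subseteq> hist_step Ag F H"
  shows "indist (unravel Ag F) G \<subseteq> indist (unravel Ag F) H"
proof -
  have "hist_step Ag F G \<union> (hist_step Ag F G)\<inverse>
      \<subseteq> hist_step Ag F H \<union> (hist_step Ag F H)\<inverse>"
    using assms by blast
  then show ?thesis
    unfolding unravel_def frame.simps by (blast intro: trancl_mono)
qed

lemma is_frame_unravel: "is_frame Ag (unravel Ag F)"
proof -
  have "indist (unravel Ag F) G \<subseteq> worlds (unravel Ag F) \<times> worlds (unravel Ag F)" for G
    unfolding unravel_def frame.simps
    by (rule trancl_subset_Sigma) (unfold hist_step_def, blast)
  moreover have "sym (indist (unravel Ag F) G)" "trans (indist (unravel Ag F) G)" for G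
    by (simp_all add: unravel_def sym_trancl sym_Un_converse)
  ultimately show ?thesis
    by (simp add: is_frame_def)
qed

text \<open>A larger pattern makes the demand \<open>G \<subseteq> U\<close> on the appended triple
  stronger, so it allows fewer steps.\<close>

lemma K3_unravel: "K3 Ag (unravel Ag F)"
  unfolding K3_def by (intro ballI impI unravel_indist_mono) (unfold hist_step_def, blast)

lemma K4_unravel:
  assumes "K4 Ag F"
  shows "K4 Ag (unravel Ag F)"
  unfolding K4_def
proof (intro ballI allI impI unravel_indist_mono subrelI)
  fix G B h h'
  assume B: "\<exists>A \<in> G. B \<noteq> {} \<and> B \<subseteq> A" and step: "(h, h') \<in> hist_step Ag F G"
  obtain U where U: "G \<subseteq> U" "h' = h @ [(last_world h, U, last_world h')]"
    "maximal_step Ag F (last_world h, U, last_world h')"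
    using hist_step_maximal[OF step] .
  \<comment> \<open>The same \<open>U\<close> witnesses the step for the enlarged pattern: some
    \<open>A\<close> above \<open>B\<close> lies in \<open>G\<close>, hence in \<open>U\<close>,
    which is closed under nonempty subsets.\<close>
  have "B \<in> U"
    using B U(1) maximal_step_closed[OF assms U(3)] by blast
  moreover have "U \<in> agent_patterns Ag"
    using U(3) by (simp add: maximal_step_def)
  ultimately show "(h, h') \<in> hist_step Ag F (G \<union> {B})"
    using step U(1,2) B unfolding hist_step_def by blast
qed

theorem theorem5p30:
  fixes Ag :: "'a set" and F :: "('a, 'w) frame"
  assumes "finite Ag"
    and "kappa_frame Ag F"
  shows "kappa_frame Ag (unravel Ag F)"
proof -
  have F: "is_frame Ag F" "K1 Ag F" "K2 Ag F" "K3 Ag F" "K4 Ag F" "NE Ag F"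
    using assms(2) by (auto simp: kappa_frame_def)
  note alive = alive_unravel[OF assms(1) F(1,4)]
  have "K1 Ag (unravel Ag F)"
    unfolding K1_def
  proof (intro ballI)
    fix G H
    assume GH: "G \<in> agent_patterns Ag" "H \<in> agent_patterns Ag"
    \<comment> \<open>The fact \<open>alive\<close> speaks only of patterns, so the union must be
      one before its aliveness can be transferred.\<close>
    then have "G \<union> H \<in> agent_patterns Ag"
      by (auto simp: agent_patterns_def)
    then show "alive (unravel Ag F) G \<inter> alive (unravel Ag F) H \<subseteq> alive (unravel Ag F) (G \<union> H)"
      using GH F(2) by (auto simp: alive K1_def)
  qed
  moreover have "K2 Ag (unravel Ag F)"
    unfolding K2_def
  proof (intro ballI)
    fix G A B
    assume G: "G \<in> agent_patterns Ag" "A \<in> G" "B \<in> G"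
    then have "{A \<union> B} \<in> agent_patterns Ag"
      by (auto simp: agent_patterns_def)
    then show "alive (unravel Ag F) G \<subseteq> alive (unravel Ag F) {A \<union> B}"
      using G F(3) by (auto simp: alive K2_def)
  qed
  moreover have "NE Ag (unravel Ag F)"
    unfolding NE_def
  proof
    fix h
    assume "h \<in> worlds (unravel Ag F)"
    then have h: "h \<in> histories Ag F"
      by (simp add: unravel_def)
    \<comment> \<open>The witness is the pattern that NE of \<open>F\<close> supplies at the last
      world of \<open>h\<close>.\<close>
    then obtain G where G: "G \<in> agent_patterns Ag" "last_world h \<in> alive F G"
      using F(6) last_world_in_worlds[OF F(1)] by (auto simp: NE_def alive_def)
    then have "h \<in> alive (unravel Ag F) G"
      using h by (simp add: alive)
    then show "\<exists>G \<in> agent_patterns Ag. (h, h) \<in> indist (unravel Ag F) G"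
      using G(1) by (auto simp: alive_def)
  qed
  ultimately show ?thesis
    using K4_unravel[OF F(5)] by (simp add: kappa_frame_def is_frame_unravel K3_unravel)
qed

end
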